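(* Let $\mathbb{F}$ be a field. (1) Let $(A,\{-,-\})$ be a Lie affebra over an $\mathbb{F}$-vector space $\overset{\to}{A}$. View $A$ as an abelian heap with ternary $\mathbb{F}$-action by setting, for all $a,b,c\in A$ and $\alpha\in\mathbb{F}$, $$[a,b,c]=a+\overrightarrow{bc},\qquad \Lambda(\alpha,a,b)=a+\alpha\,\overrightarrow{ab}.$$ If the characteristic of $\mathbb{F}$ is different from $2$, then $A$ is a heap of Lie affebras with the (ternary) bracket $$\{a,b,c\}=b+\{a,c\},\qquad a,b,c\in A,$$ and this bracket satisfies the strong Jacobi identity: for all $a,b,c,d,e\in A$, $$\{\{a,d,b\},e,c\}=\Big[\{d,e,a\},\{\{b,d,c\},e,a\},\{d,e,b\},\{\{c,d,a\},e,b\},\{d,e,c\}\Big].$$ (2) Let $(A,\{-,-,-\})$ be a heap of Lie affebras over $\mathbb{F}$. Then, for all $o\in A$, the affine space $A$ over the vector space $\overset{\to}{A}=A(o)$ is a Lie affebra with the (binary) bracket $$\{a,b\}=\{a,o,b\},\qquad a,b\in A.$$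
   Context: **Abelian heaps.** An abelian heap is a set $A$ with a ternary operation $[-,-,-]:A\times A\times A\to A$ such that for all $a_1,\dots,a_5\in A$: $[a_1,a_2,[a_3,a_4,a_5]]=[[a_1,a_2,a_3],a_4,a_5]$; $[a_1,a_2,a_2]=a_1=[a_2,a_2,a_1]$; $[a_1,a_2,a_3]=[a_3,a_2,a_1]$. A heap homomorphism is a map $f$ with $f([a_1,a_2,a_3])=[f(a_1),f(a_2),f(a_3)]$. For an odd number of elements, $[a_1,a_2,\dots,a_{2n+1}]$ denotes the repeated application of $[-,-,-]$; its value does not depend on the placing of brackets. For $o\in A$, the retract $A(o)$ is the abelian group on the set $A$ with neutral element $o$, addition $a+b=[a,o,b]$ and inverses $-a=[o,a,o]$; in $A(o)$ one has $[a,b,c]=a-b+c$. **Affine spaces.** An affine space over a field $\mathbb{F}$ is a non-empty abelian heap $A$ with an operation $\Lambda:\mathbb{F}\times A\times A\to A$ such that for all $\alpha,\beta,\gamma\in\mathbb{F}$, $a,b,c,d\in A$: - $\Lambda(\alpha-\beta+\gamma,a,b)=[\Lambda(\alpha,a,b),\Lambda(\beta,a,b),\Lambda(\gamma,a,b)]$; - $\Lambda(\alpha,a,[b,c,d])=[\Lambda(\alpha,a,b),\Lambda(\alpha,a,c),\Lambda(\alpha,a,d)]$; - $\Lambda(\alpha\beta,a,b)=\Lambda(\alpha,a,\Lambda(\beta,a,b))$; - $\Lambda(\alpha,a,b)=[\Lambda(\alpha,c,b),\Lambda(\alpha,c,a),a]$; - $\Lambda(0,a,b)=a=\Lambda(1,b,a)$.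 An affine transformation (homomorphism of affine spaces) is a heap homomorphism $f$ with $f(\Lambda(\alpha,a,b))=\Lambda(\alpha,f(a),f(b))$. This is equivalent to the usual definition of an affine space as a set $A$ with a free and transitive action of an $\mathbb{F}$-vector space $\overset{\to}{A}$, where $\overrightarrow{ab}\in\overset{\to}{A}$ denotes the unique vector with $b=a+\overrightarrow{ab}$, via $[a,b,c]=a+\overrightarrow{bc}$, $\Lambda(\alpha,a,b)=a+\alpha\overrightarrow{ab}$. Given $(A,\Lambda)$ and $o\in A$, the group $A(o)$ is an $\mathbb{F}$-vector space with $\alpha a=\Lambda(\alpha,o,a)$, and $A$ is an affine space over $\overset{\to}{A}=A(o)$ with action $a+v=[a,o,v]$ and $\overrightarrow{ab}=[o,a,b]$. **Heaps of Lie affebras.** A Lie bracket on an abelian heap $A$ is a function $\{-,-,-\}:A\times A\times A\to A$ such that for all $a,b\in A$ the maps $\{a,b,-\},\{a,-,b\},\{-,a,b\}:A\to A$ are heap homomorphisms and for all $a,b,c,o\in A$: - $\{a,b,a\}=b$; - $\big[\{a,b,c\},b,\{c,b,a\}\big]=b$; - $\{\{a,o,b\},o,c\}=\Big[\{o,o,a\},\{\{b,o,c\},o,a\},\{o,o,b\},\{\{c,o,a\},o,b\},\{o,o,c\}\Big]$. If $A$ is an affine space and for all $a,b\in A$ the maps $\{a,b,-\},\{a,-,b\},\{-,a,b\}:A\to A$ are affine transformations, then $A$ with such a Lie bracket is called a heap of Lie affebras. **Lie affebras.** A Lie affebra is an affine space $A$ over a vector space $\overset{\to}{A}$ with a bi-affine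 operation (affine in each argument) $\{-,-\}:A\times A\to\overset{\to}{A}$ that is anti-symmetric, $\{a,b\}=-\{b,a\}$, and satisfies the Jacobi identity $${}_v\{\{a,b\},c\}+{}_v\{\{b,c\},a\}+{}_v\{\{c,a\},b\}=0$$ for all $a,b,c\in A$, where ${}_v\{-,-\}:\overset{\to}{A}\times A\to\overset{\to}{A}$ is the linearisation in the first argument: for each $c\in A$, ${}_v\{-,c\}$ is the linear part of the affine map $\{-,c\}$, i.e. $\{a+v,c\}=\{a,c\}+{}_v\{v,c\}$ for all $a\in A$, $v\in\overset{\to}{A}$. *)

theory Defs
  imports "HOL-Algebra.Module" "HOL-Algebra.Multiplicative_Group"
begin

text \<open>Heap and affine operations are total functions on a type; all axioms are relativised to a
  carrier set \<open>A\<close>. Scalars form a HOL-Algebra field \<open>F\<close>, and vector spaces are HOL-Algebra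
  modules over \<open>F\<close>.\<close>

locale abelian_heap =
  fixes A :: "'a set" and br :: "'a \<Rightarrow> 'a \<Rightarrow> 'a \<Rightarrow> 'a"
  assumes br_closed: "\<lbrakk>a \<in> A; b \<in> A; c \<in> A\<rbrakk> \<Longrightarrow> br a b c \<in> A"
    and br_assoc:
      "\<lbrakk>a1 \<in> A; a2 \<in> A; a3 \<in> A; a4 \<in> A; a5 \<in> A\<rbrakk> \<Longrightarrow>
        br a1 a2 (br a3 a4 a5) = br (br a1 a2 a3) a4 a5"
    and br_cancel_right: "\<lbrakk>a1 \<in> A; a2 \<in> A\<rbrakk> \<Longrightarrow> br a1 a2 a2 = a1"
    and br_cancel_left: "\<lbrakk>a1 \<in> A; a2 \<in> A\<rbrakk> \<Longrightarrow> br a2 a2 a1 = a1"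
    and br_commute: "\<lbrakk>a1 \<in> A; a2 \<in> A; a3 \<in> A\<rbrakk> \<Longrightarrow> br a1 a2 a3 = br a3 a2 a1"

definition br5 :: "('a \<Rightarrow> 'a \<Rightarrow> 'a \<Rightarrow> 'a) \<Rightarrow> 'a \<Rightarrow> 'a \<Rightarrow> 'a \<Rightarrow> 'a \<Rightarrow> 'a \<Rightarrow> 'a" where
  "br5 br a1 a2 a3 a4 a5 = br (br a1 a2 a3) a4 a5"

definition heap_hom ::
  "'a set \<Rightarrow> ('a \<Rightarrow> 'a \<Rightarrow> 'a \<Rightarrow> 'a) \<Rightarrow> 'b set \<Rightarrow> ('b \<Rightarrow> 'b \<Rightarrow> 'b \<Rightarrow> 'b) \<Rightarrow> ('a \<Rightarrow> 'b) \<Rightarrow> bool" where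
  "heap_hom A br B br' f \<longleftrightarrow>
     f \<in> A \<rightarrow> B \<and>
     (\<forall>a\<in>A. \<forall>b\<in>A. \<forall>c\<in>A. f (br a b c) = br' (f a) (f b) (f c))"

locale affine_heap = field F + abelian_heap A br
  for F :: "('f, 'm) ring_scheme" (structure)
    and A :: "'a set" and br :: "'a \<Rightarrow> 'a \<Rightarrow> 'a \<Rightarrow> 'a" +
  fixes \<Lambda> :: "'f \<Rightarrow> 'a \<Rightarrow> 'a \<Rightarrow> 'a"
  assumes nonempty: "A \<noteq> {}"
    and Lam_closed: "\<lbrakk>\<alpha> \<in> carrier F; a \<in> A; b \<in> A\<rbrakk> \<Longrightarrow> \<Lambda> \<alpha> a b \<in> A"
    and Lam_heap_scalar:
      "\<lbrakk>\<alpha> \<in> carrier F; \<beta> \<in> carrier F; \<gamma> \<in> carrier F; a \<in> A; b \<in> A\<rbrakk> \<Longrightarrow>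
        \<Lambda> ((\<alpha> \<ominus> \<beta>) \<oplus> \<gamma>) a b = br (\<Lambda> \<alpha> a b) (\<Lambda> \<beta> a b) (\<Lambda> \<gamma> a b)"
    and Lam_heap_point:
      "\<lbrakk>\<alpha> \<in> carrier F; a \<in> A; b \<in> A; c \<in> A; d \<in> A\<rbrakk> \<Longrightarrow>
        \<Lambda> \<alpha> a (br b c d) = br (\<Lambda> \<alpha> a b) (\<Lambda> \<alpha> a c) (\<Lambda> \<alpha> a d)"
    and Lam_mult:
      "\<lbrakk>\<alpha> \<in> carrier F; \<beta> \<in> carrier F; a \<in> A; b \<in> A\<rbrakk> \<Longrightarrow>
        \<Lambda> (\<alpha> \<otimes> \<beta>) a b = \<Lambda> \<alpha> a (\<Lambda> \<beta> a b)"
    and Lam_base_change: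
      "\<lbrakk>\<alpha> \<in> carrier F; a \<in> A; b \<in> A; c \<in> A\<rbrakk> \<Longrightarrow>
        \<Lambda> \<alpha> a b = br (\<Lambda> \<alpha> c b) (\<Lambda> \<alpha> c a) a"
    and Lam_zero: "\<lbrakk>a \<in> A; b \<in> A\<rbrakk> \<Longrightarrow> \<Lambda> \<zero> a b = a"
    and Lam_one: "\<lbrakk>a \<in> A; b \<in> A\<rbrakk> \<Longrightarrow> \<Lambda> \<one> b a = a"

definition affine_hom ::
  "('f, 'm) ring_scheme \<Rightarrow> 'a set \<Rightarrow> ('a \<Rightarrow> 'a \<Rightarrow> 'a \<Rightarrow> 'a) \<Rightarrow> ('f \<Rightarrow> 'a \<Rightarrow> 'a \<Rightarrow> 'a) \<Rightarrow>
   'b set \<Rightarrow> ('b \<Rightarrow> 'b \<Rightarrow> 'b \<Rightarrow> 'b) \<Rightarrow> ('f \<Rightarrow> 'b \<Rightarrow> 'b \<Rightarrow> 'b) \<Rightarrow> ('a \<Rightarrow> 'b) \<Rightarrow> bool" where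
  "affine_hom F A br \<Lambda> B br' \<Lambda>' f \<longleftrightarrow>
     heap_hom A br B br' f \<and>
     (\<forall>\<alpha>\<in>carrier F. \<forall>a\<in>A. \<forall>b\<in>A. f (\<Lambda> \<alpha> a b) = \<Lambda>' \<alpha> (f a) (f b))"

text \<open>Affine spaces in the sense of a free and transitive action \<open>act a v = a + v\<close> of a vector
  space \<open>V\<close> on \<open>A\<close>.\<close>

locale affine_torsor = field F + module F V
  for F :: "('f, 'm) ring_scheme" (structure)
    and V :: "('f, 'v, 'n) module_scheme" +
  fixes A :: "'a set" and act :: "'a \<Rightarrow> 'v \<Rightarrow> 'a"
  assumes nonempty: "A \<noteq> {}"
    and act_closed: "\<lbrakk>a \<in> A; v \<in> carrier V\<rbrakk> \<Longrightarrow> act a v \<in> A"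
    and act_zero: "a \<in> A \<Longrightarrow> act a \<zero>\<^bsub>V\<^esub> = a"
    and act_add:
      "\<lbrakk>a \<in> A; v \<in> carrier V; w \<in> carrier V\<rbrakk> \<Longrightarrow> act a (v \<oplus>\<^bsub>V\<^esub> w) = act (act a v) w"
    and act_free: "\<lbrakk>a \<in> A; v \<in> carrier V; act a v = a\<rbrakk> \<Longrightarrow> v = \<zero>\<^bsub>V\<^esub>"
    and act_transitive: "\<lbrakk>a \<in> A; b \<in> A\<rbrakk> \<Longrightarrow> \<exists>v\<in>carrier V. b = act a v"

definition arrow ::
  "('f, 'v, 'n) module_scheme \<Rightarrow> ('a \<Rightarrow> 'v \<Rightarrow> 'a) \<Rightarrow> 'a \<Rightarrow> 'a \<Rightarrow> 'v" where
  "arrow V act a b = (THE v. v \<in> carrier V \<and> b = act a v)"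

definition torsor_heap ::
  "('f, 'v, 'n) module_scheme \<Rightarrow> ('a \<Rightarrow> 'v \<Rightarrow> 'a) \<Rightarrow> 'a \<Rightarrow> 'a \<Rightarrow> 'a \<Rightarrow> 'a" where
  "torsor_heap V act a b c = act a (arrow V act b c)"

definition torsor_Lam ::
  "('f, 'v, 'n) module_scheme \<Rightarrow> ('a \<Rightarrow> 'v \<Rightarrow> 'a) \<Rightarrow> 'f \<Rightarrow> 'a \<Rightarrow> 'a \<Rightarrow> 'a" where
  "torsor_Lam V act \<alpha> a b = act a (\<alpha> \<odot>\<^bsub>V\<^esub> arrow V act a b)"

text \<open>The target of an affine map from \<open>A\<close> to \<open>V\<close> is \<open>V\<close> as an affine space over itself,
  acting by translation.\<close>

definition affine_to_vectors ::
  "('f, 'm) ring_scheme \<Rightarrow> ('f, 'v, 'n) module_scheme \<Rightarrow> 'a set \<Rightarrow> ('a \<Rightarrow> 'v \<Rightarrow> 'a) \<Rightarrow>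
   ('a \<Rightarrow> 'v) \<Rightarrow> bool" where
  "affine_to_vectors F V A act f \<longleftrightarrow>
     affine_hom F A (torsor_heap V act) (torsor_Lam V act)
       (carrier V) (torsor_heap V (add V)) (torsor_Lam V (add V)) f"

definition linear_part ::
  "('f, 'v, 'n) module_scheme \<Rightarrow> 'a set \<Rightarrow> ('a \<Rightarrow> 'v \<Rightarrow> 'a) \<Rightarrow> ('a \<Rightarrow> 'v) \<Rightarrow> 'v \<Rightarrow> 'v" where
  "linear_part V A act f v =
     (THE w. w \<in> carrier V \<and> (\<forall>a\<in>A. f (act a v) = f a \<oplus>\<^bsub>V\<^esub> w))"

locale lie_affebra = affine_torsor F V A act
  for F :: "('f, 'm) ring_scheme" (structure)
    and V :: "('f, 'v, 'n) module_scheme"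
    and A :: "'a set" and act :: "'a \<Rightarrow> 'v \<Rightarrow> 'a" +
  fixes lie :: "'a \<Rightarrow> 'a \<Rightarrow> 'v"
  assumes lie_affine_left: "b \<in> A \<Longrightarrow> affine_to_vectors F V A act (\<lambda>a. lie a b)"
    and lie_affine_right: "a \<in> A \<Longrightarrow> affine_to_vectors F V A act (\<lambda>b. lie a b)"
    and lie_antisym: "\<lbrakk>a \<in> A; b \<in> A\<rbrakk> \<Longrightarrow> lie a b = \<ominus>\<^bsub>V\<^esub> lie b a"
    and lie_jacobi:
      "\<lbrakk>a \<in> A; b \<in> A; c \<in> A\<rbrakk> \<Longrightarrow>
        linear_part V A act (\<lambda>x. lie x c) (lie a b)
        \<oplus>\<^bsub>V\<^esub> linear_part V A act (\<lambda>x. lie x a) (lie b c)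
        \<oplus>\<^bsub>V\<^esub> linear_part V A act (\<lambda>x. lie x b) (lie c a) = \<zero>\<^bsub>V\<^esub>"

locale lie_heap = abelian_heap A br
  for A :: "'a set" and br :: "'a \<Rightarrow> 'a \<Rightarrow> 'a \<Rightarrow> 'a" +
  fixes tern :: "'a \<Rightarrow> 'a \<Rightarrow> 'a \<Rightarrow> 'a"
  assumes tern_hom_3: "\<lbrakk>a \<in> A; b \<in> A\<rbrakk> \<Longrightarrow> heap_hom A br A br (\<lambda>x. tern a b x)"
    and tern_hom_2: "\<lbrakk>a \<in> A; b \<in> A\<rbrakk> \<Longrightarrow> heap_hom A br A br (\<lambda>x. tern a x b)"
    and tern_hom_1: "\<lbrakk>a \<in> A; b \<in> A\<rbrakk> \<Longrightarrow> heap_hom A br A br (\<lambda>x. tern x a b)"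
    and tern_idem: "\<lbrakk>a \<in> A; b \<in> A\<rbrakk> \<Longrightarrow> tern a b a = b"
    and tern_antisym:
      "\<lbrakk>a \<in> A; b \<in> A; c \<in> A\<rbrakk> \<Longrightarrow> br (tern a b c) b (tern c b a) = b"
    and tern_jacobi:
      "\<lbrakk>a \<in> A; b \<in> A; c \<in> A; p \<in> A\<rbrakk> \<Longrightarrow>
        tern (tern a p b) p c =
          br5 br (tern p p a) (tern (tern b p c) p a) (tern p p b)
            (tern (tern c p a) p b) (tern p p c)"

locale heap_of_lie_affebras = affine_heap F A br \<Lambda> + lie_heap A br tern
  for F :: "('f, 'm) ring_scheme" (structure)
    and A :: "'a set" and br :: "'a \<Rightarrow> 'a \<Rightarrow> 'a \<Rightarrow> 'a"
    and \<Lambda> :: "'f \<Rightarrow> 'a \<Rightarrow> 'a \<Rightarrow> 'a" and tern :: "'a \<Rightarrow> 'a \<Rightarrow> 'a \<Rightarrow> 'a" +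
  assumes tern_affine_3: "\<lbrakk>a \<in> A; b \<in> A\<rbrakk> \<Longrightarrow> affine_hom F A br \<Lambda> A br \<Lambda> (\<lambda>x. tern a b x)"
    and tern_affine_2: "\<lbrakk>a \<in> A; b \<in> A\<rbrakk> \<Longrightarrow> affine_hom F A br \<Lambda> A br \<Lambda> (\<lambda>x. tern a x b)"
    and tern_affine_1: "\<lbrakk>a \<in> A; b \<in> A\<rbrakk> \<Longrightarrow> affine_hom F A br \<Lambda> A br \<Lambda> (\<lambda>x. tern x a b)"

definition strong_jacobi ::
  "'a set \<Rightarrow> ('a \<Rightarrow> 'a \<Rightarrow> 'a \<Rightarrow> 'a) \<Rightarrow> ('a \<Rightarrow> 'a \<Rightarrow> 'a \<Rightarrow> 'a) \<Rightarrow> bool" where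
  "strong_jacobi A br tern \<longleftrightarrow>
     (\<forall>a\<in>A. \<forall>b\<in>A. \<forall>c\<in>A. \<forall>d\<in>A. \<forall>e\<in>A.
        tern (tern a d b) e c =
          br5 br (tern d e a) (tern (tern b d c) e a) (tern d e b)
            (tern (tern c d a) e b) (tern d e c))"

text \<open>The retract \<open>A(p)\<close> as a vector space. The fields \<open>mult\<close> and \<open>one\<close> of the record are
  inherited from rings and play no role in the locale \<^locale>\<open>module\<close>.\<close>

definition retract ::
  "'a set \<Rightarrow> ('a \<Rightarrow> 'a \<Rightarrow> 'a \<Rightarrow> 'a) \<Rightarrow> ('f \<Rightarrow> 'a \<Rightarrow> 'a \<Rightarrow> 'a) \<Rightarrow> 'a \<Rightarrow> ('f, 'a) module" where
  "retract A br \<Lambda> p =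
     \<lparr>carrier = A, mult = undefined, one = undefined,
      zero = p, add = (\<lambda>a b. br a p b), smult = (\<lambda>\<alpha> a. \<Lambda> \<alpha> p a)\<rparr>"

text \<open>The characteristic is the additive order of \<open>1\<close>; \<^const>\<open>group.ord\<close> is \<open>0\<close> on elements of
  infinite order.\<close>

definition ring_char :: "('f, 'm) ring_scheme \<Rightarrow> nat" where
  "ring_char R = group.ord (add_monoid R) \<one>\<^bsub>R\<^esub>"

end

theory Submission
  imports Defs
begin

text \<open>In coordinates \<open>a = q + u\<close> with respect to an origin \<open>q\<close>, the torsor operations become
  \<open>u - v + w\<close> and \<open>u + \<alpha> (v - u)\<close>, so all axioms turn into identities in a vector space.
  In part (1), \<open>{{a,d,b},e,c} = e + {d,c} + \<^sub>v{{a,b},c}\<close>; hence on both sides of the strong Jacobi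
  identity the terms \<open>{d,a}\<close> and \<open>{d,b}\<close> cancel and what remains is the Jacobi identity of the
  linear parts. Characteristic different from \<open>2\<close> is needed only to get \<open>{a,a} = 0\<close>, that is
  \<open>{a,b,a} = b\<close>. In part (2), the torsor operations of the retract \<open>A(p)\<close> are the original
  ones, and the linear part of \<open>{-,p,c}\<close> is \<open>v \<mapsto> {v,p,c} - {p,p,c}\<close>, so the ternary
  Jacobi identity at \<open>p\<close> is the binary one.\<close>

section \<open>Cancellation in abelian groups\<close>

lemma (in abelian_group) add_minus_cancel:
  assumes "x \<in> carrier G" "y \<in> carrier G"
  shows "x \<oplus> (y \<ominus> x) = y" "x \<oplus> y \<ominus> y = x" "x \<ominus> (x \<oplus> y) = \<ominus> y"
  using assms
  by (simp_all add: minus_eq a_lcomm[of x y] a_assoc r_neg minus_add r_neg2)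

lemma (in abelian_group) minus_minus_swap:
  assumes "x \<in> carrier G" "y \<in> carrier G"
  shows "\<ominus> (x \<ominus> y) = y \<ominus> x"
  using assms by (simp add: minus_eq minus_add a_comm)

section \<open>Affine spaces in coordinates\<close>

context affine_torsor
begin

text \<open>If v and w both carry a to the same point, then w - v fixes that point, so freeness
  gives w = v. This settles the uniqueness demanded by the definite description in
  \<open>arrow\<close>.\<close>

lemma arrow_eq:
  assumes "a \<in> A" "v \<in> carrier V"
  shows "arrow V act a (act a v) = v"
  unfolding arrow_def
proof (rule the_equality)
  fix w assume w: "w \<in> carrier V \<and> act a v = act a w"
  have "act (act a v) (w \<ominus>\<^bsub>V\<^esub> v) = act a (v \<oplus>\<^bsub>V\<^esub> (w \<ominus>\<^bsub>V\<^esub> v))"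
    using assms w by (simp add: act_add)
  also have "v \<oplus>\<^bsub>V\<^esub> (w \<ominus>\<^bsub>V\<^esub> v) = w"
    using assms w by (simp add: M.add_minus_cancel)
  finally have "act (act a v) (w \<ominus>\<^bsub>V\<^esub> v) = act a v" using w by simp
  then have "w \<ominus>\<^bsub>V\<^esub> v = \<zero>\<^bsub>V\<^esub>" using act_free[of "act a v"] assms w act_closed by simp
  then show "w = v" using assms w M.add_minus_cancel(1)[of v w] by simp
qed (use assms in simp)

lemma act_inject:
  assumes "a \<in> A" "v \<in> carrier V" "w \<in> carrier V"
  shows "act a v = act a w \<longleftrightarrow> v = w"
  using arrow_eq assms by metis

lemma arrow_closed: "\<lbrakk>a \<in> A; b \<in> A\<rbrakk> \<Longrightarrow> arrow V act a b \<in> carrier V"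
  using act_transitive arrow_eq by metis

lemma act_arrow: "\<lbrakk>a \<in> A; b \<in> A\<rbrakk> \<Longrightarrow> act a (arrow V act a b) = b"
  using act_transitive arrow_eq by metis

text \<open>Heap bracket and scalar action of the torsor are both defined through
  \<open>arrow\<close>, so this formula is what turns them into vector arithmetic.\<close>

lemma arrow_coord:
  assumes [simp]: "q \<in> A" "u \<in> carrier V" "v \<in> carrier V"
  shows "arrow V act (act q u) (act q v) = v \<ominus>\<^bsub>V\<^esub> u"
proof -
  have "u \<oplus>\<^bsub>V\<^esub> (v \<ominus>\<^bsub>V\<^esub> u) = v"
    by (simp add: M.add_minus_cancel)
  then have "act q v = act (act q u) (v \<ominus>\<^bsub>V\<^esub> u)"
    by (simp flip: act_add)
  then show ?thesis by (simp add: arrow_eq act_closed)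
qed

lemma torsor_heap_coord:
  assumes "q \<in> A" "u \<in> carrier V" "v \<in> carrier V" "w \<in> carrier V"
  shows "torsor_heap V act (act q u) (act q v) (act q w) = act q (u \<ominus>\<^bsub>V\<^esub> v \<oplus>\<^bsub>V\<^esub> w)"
  using assms
  by (simp add: torsor_heap_def arrow_coord M.minus_eq M.a_ac flip: act_add)

lemma torsor_Lam_coord:
  assumes "q \<in> A" "\<alpha> \<in> carrier F" "u \<in> carrier V" "v \<in> carrier V"
  shows "torsor_Lam V act \<alpha> (act q u) (act q v)
         = act q (u \<oplus>\<^bsub>V\<^esub> \<alpha> \<odot>\<^bsub>V\<^esub> (v \<ominus>\<^bsub>V\<^esub> u))"
  using assms
  by (simp add: torsor_Lam_def arrow_coord flip: act_add)

lemma coord_cases: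
  assumes "q \<in> A" "a \<in> A"
  obtains u where "u \<in> carrier V" "a = act q u"
  using act_transitive assms by blast

section \<open>The affine space axioms for a torsor\<close>

lemma smult_minus:
  assumes "\<alpha> \<in> carrier F" "u \<in> carrier V" "v \<in> carrier V"
  shows "\<alpha> \<odot>\<^bsub>V\<^esub> (u \<ominus>\<^bsub>V\<^esub> v) = \<alpha> \<odot>\<^bsub>V\<^esub> u \<ominus>\<^bsub>V\<^esub> \<alpha> \<odot>\<^bsub>V\<^esub> v"
  using assms by (simp add: M.minus_eq smult_r_distr smult_r_minus)

lemma minus_smult:
  assumes "\<alpha> \<in> carrier F" "\<beta> \<in> carrier F" "u \<in> carrier V"
  shows "(\<alpha> \<ominus> \<beta>) \<odot>\<^bsub>V\<^esub> u = \<alpha> \<odot>\<^bsub>V\<^esub> u \<ominus>\<^bsub>V\<^esub> \<beta> \<odot>\<^bsub>V\<^esub> u"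
  using assms by (simp add: a_minus_def smult_l_distr smult_l_minus)

lemma abelian_heap_torsor: "abelian_heap A (torsor_heap V act)"
proof
  fix a b c assume *: "a \<in> A" "b \<in> A" "c \<in> A"
  show "torsor_heap V act a b c \<in> A"
    using * by (simp add: torsor_heap_def arrow_closed act_closed)
next
  fix a b c d e assume *: "a \<in> A" "b \<in> A" "c \<in> A" "d \<in> A" "e \<in> A"
  then obtain w x y z where c: "w \<in> carrier V" "b = act a w" "x \<in> carrier V" "c = act a x"
    "y \<in> carrier V" "d = act a y" "z \<in> carrier V" "e = act a z" and a: "a = act a \<zero>\<^bsub>V\<^esub>"
    by (metis coord_cases act_zero)
  \<comment> \<open>The point a serves as origin. It has to appear with its own coordinate, the zero
    vector, for \<open>torsor_heap_coord\<close> to apply.\<close>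
  have "torsor_heap V act (act a \<zero>\<^bsub>V\<^esub>) b (torsor_heap V act c d e) =
        torsor_heap V act (torsor_heap V act (act a \<zero>\<^bsub>V\<^esub>) b c) d e"
    using * c(1,3,5,7) unfolding c(2,4,6,8)
    by (simp add: torsor_heap_coord M.minus_eq M.a_ac)
  then show "torsor_heap V act a b (torsor_heap V act c d e) =
        torsor_heap V act (torsor_heap V act a b c) d e"
    using a by simp
next
  fix a b assume *: "a \<in> A" "b \<in> A"
  show "torsor_heap V act a b b = a"
    using * act_arrow[of b b] unfolding torsor_heap_def
    by (metis act_zero arrow_eq M.zero_closed)
  show "torsor_heap V act b b a = a"
    using * unfolding torsor_heap_def by (simp add: act_arrow)
next
  fix a b c assume *: "a \<in> A" "b \<in> A" "c \<in> A"
  then obtain x y where c: "x \<in> carrier V" "b = act a x" "y \<in> carrier V" "c = act a y"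
     and a: "a = act a \<zero>\<^bsub>V\<^esub>"
    by (metis coord_cases act_zero)
  have "torsor_heap V act (act a \<zero>\<^bsub>V\<^esub>) b c = torsor_heap V act c b (act a \<zero>\<^bsub>V\<^esub>)"
    using * c(1,3) unfolding c(2,4)
    by (simp add: torsor_heap_coord M.minus_eq M.a_ac)
  then show "torsor_heap V act a b c = torsor_heap V act c b a" using a by simp
qed

lemma affine_heap_torsor: "affine_heap F A (torsor_heap V act) (torsor_Lam V act)"
proof -
  interpret H: abelian_heap A "torsor_heap V act" by (rule abelian_heap_torsor)
  let ?T = "torsor_heap V act" and ?L = "torsor_Lam V act"
  show ?thesis
  proof
    show "A \<noteq> {}" by (rule nonempty)
  next
    fix \<alpha> a b assume "\<alpha> \<in> carrier F" "a \<in> A" "b \<in> A"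
    then show "?L \<alpha> a b \<in> A" by (simp add: torsor_Lam_def arrow_closed act_closed)
  next
    fix \<alpha> \<beta> \<gamma> a b
    assume *: "\<alpha> \<in> carrier F" "\<beta> \<in> carrier F" "\<gamma> \<in> carrier F" "a \<in> A" "b \<in> A"
    have "?L \<delta> a b = act a (\<delta> \<odot>\<^bsub>V\<^esub> arrow V act a b)" for \<delta>
      by (simp add: torsor_Lam_def)
    then show "?L ((\<alpha> \<ominus> \<beta>) \<oplus> \<gamma>) a b = ?T (?L \<alpha> a b) (?L \<beta> a b) (?L \<gamma> a b)"
      using * by (simp add: torsor_heap_coord arrow_closed smult_l_distr minus_smult)
  next
    fix \<alpha> a b c d
    assume *: "\<alpha> \<in> carrier F" "a \<in> A" "b \<in> A" "c \<in> A" "d \<in> A"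
    then obtain x y z where c: "x \<in> carrier V" "b = act a x"
      "y \<in> carrier V" "c = act a y" "z \<in> carrier V" "d = act a z"
      by (metis coord_cases)
    show "?L \<alpha> a (?T b c d) = ?T (?L \<alpha> a b) (?L \<alpha> a c) (?L \<alpha> a d)"
      using * c(1,3,5) unfolding c(2,4,6)
      by (simp add: torsor_heap_coord torsor_Lam_def arrow_eq smult_r_distr smult_minus)
  next
    fix \<alpha> \<beta> a b assume *: "\<alpha> \<in> carrier F" "\<beta> \<in> carrier F" "a \<in> A" "b \<in> A"
    then show "?L (\<alpha> \<otimes> \<beta>) a b = ?L \<alpha> a (?L \<beta> a b)"
      by (simp add: torsor_Lam_def arrow_eq arrow_closed smult_assoc1)
  next
    fix \<alpha> a b c assume *: "\<alpha> \<in> carrier F" "a \<in> A" "b \<in> A" "c \<in> A"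
    \<comment> \<open>With c as origin, scaling based at c multiplies coordinates by \<alpha>, and
      the claim reads x + \<alpha>(y - x) = \<alpha>y - \<alpha>x + x.\<close>
    then obtain x y where c: "x \<in> carrier V" "a = act c x" "y \<in> carrier V" "b = act c y"
      by (metis coord_cases)
    show "?L \<alpha> a b = ?T (?L \<alpha> c b) (?L \<alpha> c a) a"
      using * c(1,3) unfolding c(2,4)
      by (simp add: torsor_Lam_coord torsor_heap_coord,
          simp add: torsor_Lam_def arrow_eq torsor_heap_coord smult_minus)
        (simp add: M.minus_eq M.a_ac)
  next
    fix a b assume *: "a \<in> A" "b \<in> A"
    show "?L \<zero> a b = a" using * by (simp add: torsor_Lam_def arrow_closed act_zero)
    show "?L \<one> b a = a" using * by (simp add: torsor_Lam_def arrow_closed act_arrow)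
  qed
qed

section \<open>Affine maps into the vector space and their linear parts\<close>

lemma affine_torsor_vectors: "affine_torsor F V (carrier V) (add V)"
  by unfold_locales
    (use M.zero_closed in \<open>auto simp: M.a_assoc\<close>,
     metis M.add.inv_closed M.a_closed M.add.inv_solve_left)

text \<open>With the zero vector as origin, every vector is its own coordinate.\<close>

lemma vector_heap_eq:
  assumes "u \<in> carrier V" "v \<in> carrier V" "w \<in> carrier V"
  shows "torsor_heap V (add V) u v w = u \<ominus>\<^bsub>V\<^esub> v \<oplus>\<^bsub>V\<^esub> w"
  using affine_torsor.torsor_heap_coord[OF affine_torsor_vectors, of "\<zero>\<^bsub>V\<^esub>" u v w] assms
  by simp

lemma vector_Lam_eq:
  assumes "\<alpha> \<in> carrier F" "u \<in> carrier V" "v \<in> carrier V"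
  shows "torsor_Lam V (add V) \<alpha> u v = u \<oplus>\<^bsub>V\<^esub> \<alpha> \<odot>\<^bsub>V\<^esub> (v \<ominus>\<^bsub>V\<^esub> u)"
  using affine_torsor.torsor_Lam_coord[OF affine_torsor_vectors, of "\<zero>\<^bsub>V\<^esub>" \<alpha> u v] assms
  by simp

text \<open>The increment is determined by its effect at a single point, and \<open>nonempty\<close>
  supplies one.\<close>

lemma linear_part_eqI:
  assumes "f \<in> A \<rightarrow> carrier V" "w \<in> carrier V"
    and "\<And>a. a \<in> A \<Longrightarrow> f (act a v) = f a \<oplus>\<^bsub>V\<^esub> w"
  shows "linear_part V A act f v = w"
  unfolding linear_part_def
proof (rule the_equality)
  fix w' assume w': "w' \<in> carrier V \<and> (\<forall>a\<in>A. f (act a v) = f a \<oplus>\<^bsub>V\<^esub> w')"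
  obtain a where a: "a \<in> A" using nonempty by blast
  then have "f a \<in> carrier V" "f a \<oplus>\<^bsub>V\<^esub> w' = f a \<oplus>\<^bsub>V\<^esub> w" using w' assms by auto
  then show "w' = w" using w' assms by simp
qed (use assms in auto)

lemma affine_to_vectors_closed:
  "affine_to_vectors F V A act f \<Longrightarrow> f \<in> A \<rightarrow> carrier V"
  by (simp add: affine_to_vectors_def affine_hom_def heap_hom_def)

text \<open>The point a + v is the heap bracket of a, q and q + v, so f sends it to f(a) + (f(q + v)
  - f(q)). The increment measured at one point q therefore serves at every a.\<close>

lemma affine_to_vectors_linear_part:
  assumes f: "affine_to_vectors F V A act f" and v: "v \<in> carrier V"
  shows "linear_part V A act f v \<in> carrier V"
    and "a \<in> A \<Longrightarrow> f (act a v) = f a \<oplus>\<^bsub>V\<^esub> linear_part V A act f v"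
proof -
  have fV: "f x \<in> carrier V" if "x \<in> A" for x using affine_to_vectors_closed[OF f] that by auto
  obtain q where q: "q \<in> A" using nonempty by blast
  define w where "w = f (act q v) \<ominus>\<^bsub>V\<^esub> f q"
  have w: "w \<in> carrier V" by (simp add: w_def fV q v act_closed)
  have *: "f (act a v) = f a \<oplus>\<^bsub>V\<^esub> w" if a: "a \<in> A" for a
  proof -
    have "act a v = torsor_heap V act a q (act q v)"
      using a q v by (simp add: torsor_heap_def arrow_eq)
    then have "f (act a v) = torsor_heap V (add V) (f a) (f q) (f (act q v))"
      using f a q v by (simp add: affine_to_vectors_def affine_hom_def heap_hom_def act_closed)
    also have "\<dots> = f a \<oplus>\<^bsub>V\<^esub> w"
      using a q v by (simp add: vector_heap_eq fV act_closed w_def M.minus_eq M.a_ac)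
    finally show ?thesis .
  qed
  have "linear_part V A act f v = w"
    by (rule linear_part_eqI) (use fV w * in auto)
  then show "linear_part V A act f v \<in> carrier V"
    and "a \<in> A \<Longrightarrow> f (act a v) = f a \<oplus>\<^bsub>V\<^esub> linear_part V A act f v"
    using w * by auto
qed

text \<open>By the coordinate formulas with origin b, \<open>act b\<close> carries the affine
  operations of the vectors to those of A. This handles the two outer arguments of the bracket b +
  {a,c}.\<close>

lemma affine_hom_act_left:
  assumes f: "affine_to_vectors F V A act f" and b: "b \<in> A"
  shows "affine_hom F A (torsor_heap V act) (torsor_Lam V act)
           A (torsor_heap V act) (torsor_Lam V act) (\<lambda>x. act b (f x))"
proof -
  have fV: "f x \<in> carrier V" if "x \<in> A" for x using affine_to_vectors_closed[OF f] that by auto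
  show ?thesis
    using f b unfolding affine_to_vectors_def affine_hom_def heap_hom_def
    by (auto simp: fV act_closed torsor_heap_coord torsor_Lam_coord vector_heap_eq vector_Lam_eq)
qed

text \<open>Handles the middle argument of b + {a,c}, on which the bracket is the translation by
  {a,c}.\<close>

lemma affine_hom_translation:
  assumes w: "w \<in> carrier V"
  shows "affine_hom F A (torsor_heap V act) (torsor_Lam V act)
           A (torsor_heap V act) (torsor_Lam V act) (\<lambda>x. act x w)"
  unfolding affine_hom_def heap_hom_def
proof (intro conjI ballI funcsetI)
  show "act x w \<in> A" if "x \<in> A" for x using that w by (simp add: act_closed)
next
  fix a b c assume *: "a \<in> A" "b \<in> A" "c \<in> A"
  \<comment> \<open>With b as origin the bracket of a, b, c has coordinate x + y. After translating
    all three points it becomes (x + w) - w + (y + w), so w survives exactly once.\<close>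
  then obtain x y where c: "x \<in> carrier V" "a = act b x" "y \<in> carrier V" "c = act b y"
    by (metis coord_cases)
  have "torsor_heap V act a b c = act b (x \<oplus>\<^bsub>V\<^esub> y)"
    using * c by (simp add: torsor_heap_def arrow_eq act_add)
  then have "act (torsor_heap V act a b c) w = act b (x \<oplus>\<^bsub>V\<^esub> y \<oplus>\<^bsub>V\<^esub> w)"
    using * c w by (simp add: act_add)
  also have "\<dots> = torsor_heap V act (act b (x \<oplus>\<^bsub>V\<^esub> w)) (act b w) (act b (y \<oplus>\<^bsub>V\<^esub> w))"
    using * c(1,3) w
    by (simp add: torsor_heap_coord M.add_minus_cancel M.a_assoc)
  also have "\<dots> = torsor_heap V act (act a w) (act b w) (act c w)"
    using * c w by (simp add: act_add)
  finally show "act (torsor_heap V act a b c) w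
      = torsor_heap V act (act a w) (act b w) (act c w)" .
next
  fix \<alpha> a b assume *: "\<alpha> \<in> carrier F" "a \<in> A" "b \<in> A"
  then obtain y where c: "y \<in> carrier V" "b = act a y"
    by (metis coord_cases)
  \<comment> \<open>Translation by w leaves the arrow y from a to b unchanged.\<close>
  have "act (act a y) w = act (act a w) y"
    using * c w by (simp add: M.a_comm flip: act_add)
  then show "act (torsor_Lam V act \<alpha> a b) w = torsor_Lam V act \<alpha> (act a w) (act b w)"
    using * c w
    by (simp add: torsor_Lam_def arrow_eq act_closed)
      (simp add: M.a_comm flip: act_add)
qed

end

section \<open>From Lie affebras to heaps of Lie affebras\<close>

lemma (in field) ring_char_eq_2:
  assumes "\<one> \<oplus> \<one> = \<zero>"
  shows "ring_char R = 2"
proof -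
  have "add_pow R (2::nat) \<one> = \<zero>"
    using assms by (simp add: numeral_2_eq_2 add_pow_def)
  \<comment> \<open>The value 0 of \<open>ord\<close>, which encodes infinite order, is ruled out
    because 0 does not divide 2; order 1 would mean 1 = 0.\<close>
  then have "add.ord \<one> dvd 2"
    using add.pow_eq_id[of \<one> 2] by simp
  then have "add.ord \<one> \<le> 2" "add.ord \<one> \<noteq> 0"
    by (auto dest: dvd_imp_le intro!: Nat.gr0I)
  moreover have "add.ord \<one> \<noteq> 1"
    using add.ord_eq_1[of \<one>] by simp
  ultimately show ?thesis
    unfolding ring_char_def by linarith
qed

text \<open>The hypothesis v = -v says that 1 + 1 annihilates v, and 1 + 1 is invertible because the
  characteristic is not 2.\<close>

lemma (in affine_torsor) self_eq_minus_imp_zero: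
  assumes "ring_char F \<noteq> 2" and v: "v \<in> carrier V" and "v = \<ominus>\<^bsub>V\<^esub> v"
  shows "v = \<zero>\<^bsub>V\<^esub>"
proof -
  let ?t = "\<one> \<oplus> \<one>"
  have t: "?t \<in> Units F"
    using ring_char_eq_2 assms(1) by (auto simp: field_Units)
  have "?t \<odot>\<^bsub>V\<^esub> v = v \<oplus>\<^bsub>V\<^esub> v" using v by (simp add: smult_l_distr)
  also have "\<dots> = \<zero>\<^bsub>V\<^esub>" using v assms(3) M.r_neg by metis
  finally have "inv ?t \<odot>\<^bsub>V\<^esub> (?t \<odot>\<^bsub>V\<^esub> v) = \<zero>\<^bsub>V\<^esub>" using t by simp
  then show ?thesis
    using t v by (simp flip: smult_assoc1)
qed

section \<open>The ternary bracket of a Lie affebra\<close>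

context lie_affebra
begin

lemma lie_closed: "\<lbrakk>a \<in> A; b \<in> A\<rbrakk> \<Longrightarrow> lie a b \<in> carrier V"
  using lie_affine_left[of b] affine_to_vectors_closed by blast

lemma strong_jacobi_lie:
  "strong_jacobi A (torsor_heap V act) (\<lambda>a b c. act b (lie a c))"
  unfolding strong_jacobi_def br5_def
proof (intro ballI)
  fix a b c d e assume *: "a \<in> A" "b \<in> A" "c \<in> A" "d \<in> A" "e \<in> A"
  let ?l = "\<lambda>v c. linear_part V A act (\<lambda>x. lie x c) v"
  have l: "?l v x \<in> carrier V" "lie (act d v) x = lie d x \<oplus>\<^bsub>V\<^esub> ?l v x"
    if "v \<in> carrier V" "x \<in> A" for v x
    using affine_to_vectors_linear_part[OF lie_affine_left] that * by auto
  \<comment> \<open>These are the three summands of the binary Jacobi identity.\<close>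
  define P Q R where "P = ?l (lie a b) c" and "Q = ?l (lie b c) a" and "R = ?l (lie c a) b"
  have PQR: "P \<in> carrier V" "Q \<in> carrier V" "R \<in> carrier V"
    using * by (simp_all add: P_def Q_def R_def l lie_closed)
  have "P \<oplus>\<^bsub>V\<^esub> Q \<oplus>\<^bsub>V\<^esub> R = \<zero>\<^bsub>V\<^esub>"
    using lie_jacobi[of a b c] * by (simp add: P_def Q_def R_def)
  then have P: "P = \<ominus>\<^bsub>V\<^esub> (Q \<oplus>\<^bsub>V\<^esub> R)"
    using PQR by (metis M.a_assoc M.a_closed M.minus_equality)
  define x y z where "x = lie d a" and "y = lie d b" and "z = lie d c"
  have xyz: "x \<in> carrier V" "y \<in> carrier V" "z \<in> carrier V"
    using * by (simp_all add: x_def y_def z_def lie_closed)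
  \<comment> \<open>This is the strong Jacobi identity in coordinates with origin e: x and y cancel,
    leaving z - Q - R, and P = -(Q + R).\<close>
  have "x \<ominus>\<^bsub>V\<^esub> (x \<oplus>\<^bsub>V\<^esub> Q) \<oplus>\<^bsub>V\<^esub> y \<ominus>\<^bsub>V\<^esub> (y \<oplus>\<^bsub>V\<^esub> R) \<oplus>\<^bsub>V\<^esub> z = z \<oplus>\<^bsub>V\<^esub> P"
  proof -
    have "\<ominus>\<^bsub>V\<^esub> Q \<oplus>\<^bsub>V\<^esub> y \<ominus>\<^bsub>V\<^esub> (y \<oplus>\<^bsub>V\<^esub> R) = \<ominus>\<^bsub>V\<^esub> Q \<oplus>\<^bsub>V\<^esub> (y \<ominus>\<^bsub>V\<^esub> (y \<oplus>\<^bsub>V\<^esub> R))"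
      using PQR xyz by (simp add: M.minus_eq M.a_assoc)
    then show ?thesis
      unfolding P using PQR(2,3) xyz by (simp add: M.add_minus_cancel M.minus_add) (simp add: M.a_comm)
  qed
  then have "act e (z \<oplus>\<^bsub>V\<^esub> P) = torsor_heap V act
      (torsor_heap V act (act e x) (act e (x \<oplus>\<^bsub>V\<^esub> Q)) (act e y)) (act e (y \<oplus>\<^bsub>V\<^esub> R)) (act e z)"
    using * PQR xyz by (simp add: torsor_heap_coord)
  then show "act e (lie (act d (lie a b)) c) = torsor_heap V act
      (torsor_heap V act (act e (lie d a)) (act e (lie (act d (lie b c)) a)) (act e (lie d b)))
      (act e (lie (act d (lie c a)) b)) (act e (lie d c))"
    using * by (simp add: l lie_closed x_def y_def z_def P_def Q_def R_def)
qed

lemma heap_of_lie_affebras_lie: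
  assumes char: "ring_char F \<noteq> 2"
  shows "heap_of_lie_affebras F A (torsor_heap V act) (torsor_Lam V act)
           (\<lambda>a b c. act b (lie a c))"
proof -
  let ?T = "torsor_heap V act" and ?L = "torsor_Lam V act"
  interpret H: affine_heap F A ?T ?L by (rule affine_heap_torsor)
  have h1: "affine_hom F A ?T ?L A ?T ?L (\<lambda>x. act a (lie x b))"
    and h2: "affine_hom F A ?T ?L A ?T ?L (\<lambda>x. act x (lie a b))"
    and h3: "affine_hom F A ?T ?L A ?T ?L (\<lambda>x. act b (lie a x))" if "a \<in> A" "b \<in> A" for a b
    using that
    by (auto intro!: affine_hom_act_left affine_hom_translation lie_affine_left
        lie_affine_right lie_closed)
  show ?thesis
  proof
    fix a b assume *: "a \<in> A" "b \<in> A"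
    show "heap_hom A ?T A ?T (\<lambda>x. act b (lie a x))" "heap_hom A ?T A ?T (\<lambda>x. act x (lie a b))"
      "heap_hom A ?T A ?T (\<lambda>x. act a (lie x b))"
      using h1 h2 h3 * by (auto simp: affine_hom_def)
    have "lie a a = \<zero>\<^bsub>V\<^esub>"
      using self_eq_minus_imp_zero[OF char] lie_antisym lie_closed * by blast
    then show "act b (lie a a) = b" using * by (simp add: act_zero)
  next
    fix a b c assume *: "a \<in> A" "b \<in> A" "c \<in> A"
    \<comment> \<open>With origin b the coordinate of the left side is {a,c} - 0 + {c,a}, which
      vanishes by antisymmetry.\<close>
    have "?T (act b (lie a c)) (act b \<zero>\<^bsub>V\<^esub>) (act b (lie c a)) = b"
      using * lie_closed[of c a] torsor_heap_coord[of b "lie a c" "\<zero>\<^bsub>V\<^esub>" "lie c a"]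
        M.add_minus_cancel(1)[of "\<zero>\<^bsub>V\<^esub>" "\<ominus>\<^bsub>V\<^esub> lie c a"]
      by (simp add: lie_antisym[of a c] M.l_neg act_zero)
    then show "?T (act b (lie a c)) b (act b (lie c a)) = b" using * by (simp add: act_zero)
  next
    fix a b c p assume "a \<in> A" "b \<in> A" "c \<in> A" "p \<in> A"
    \<comment> \<open>The strong Jacobi identity with d = e = p.\<close>
    then show "act p (lie (act p (lie a b)) c) = br5 ?T (act p (lie p a))
       (act p (lie (act p (lie b c)) a)) (act p (lie p b)) (act p (lie (act p (lie c a)) b))
       (act p (lie p c))"
      using strong_jacobi_lie unfolding strong_jacobi_def by blast
  qed (use h1 h2 h3 in auto)
qed

end

section \<open>From heaps of Lie affebras to Lie affebras\<close>

lemma retract_simps [simp]: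
  "carrier (retract A br \<Lambda> p) = A"
  "\<zero>\<^bsub>retract A br \<Lambda> p\<^esub> = p"
  "add (retract A br \<Lambda> p) = (\<lambda>a b. br a p b)"
  "\<alpha> \<odot>\<^bsub>retract A br \<Lambda> p\<^esub> a = \<Lambda> \<alpha> p a"
  by (simp_all add: retract_def)

lemma (in abelian_heap) abelian_group_retract:
  assumes p: "p \<in> A"
  shows "abelian_group (retract A br \<Lambda> p)"
proof (rule abelian_groupI)
  fix x assume "x \<in> carrier (retract A br \<Lambda> p)"
  \<comment> \<open>The inverse of x in the retract is \<open>br p x p\<close>.\<close>
  then have "br p x p \<in> A" "br (br p x p) p x = p"
    using p by (simp_all add: br_closed br_cancel_left br_cancel_right flip: br_assoc)
  then show "\<exists>y\<in>carrier (retract A br \<Lambda> p). y \<oplus>\<^bsub>retract A br \<Lambda> p\<^esub> x = \<zero>\<^bsub>retract A br \<Lambda> p\<^esub>"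
    by auto
qed (use p in \<open>auto simp: br_closed br_assoc br_cancel_left intro: br_commute\<close>)

text \<open>Here \<open>br p b c\<close> is the arrow from b to c as a vector of the retract at p;
  the equation says what adding it to a gives.\<close>

lemma (in abelian_heap) br_br_through:
  assumes "a \<in> A" "b \<in> A" "c \<in> A" "p \<in> A"
  shows "br a p (br p b c) = br a b c"
  using assms by (simp add: br_assoc br_cancel_right)

text \<open>Since -b is \<open>br p b p\<close>, the sum a - b + c is a chain of brackets in which
  the inner copies of p cancel.\<close>

lemma (in abelian_heap) br_retract:
  assumes "a \<in> A" "b \<in> A" "c \<in> A" "p \<in> A"
  shows "br a b c = a \<ominus>\<^bsub>retract A br \<Lambda> p\<^esub> b \<oplus>\<^bsub>retract A br \<Lambda> p\<^esub> c"
proof -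
  interpret R: abelian_group "retract A br \<Lambda> p" by (rule abelian_group_retract) fact
  have "br (br p b p) p b = p"
    using assms by (simp add: br_cancel_left br_cancel_right flip: br_assoc)
  then have "\<ominus>\<^bsub>retract A br \<Lambda> p\<^esub> b = br p b p"
    using R.minus_equality[of "br p b p" b] assms by (simp add: br_closed)
  then show ?thesis
    using assms by (simp add: R.minus_eq br_closed br_br_through)
      (simp add: br_closed br_cancel_left flip: br_assoc)
qed

section \<open>The retract as a vector space acting on the heap\<close>

context affine_heap
begin

lemma Lam_same: "\<lbrakk>\<alpha> \<in> carrier F; p \<in> A\<rbrakk> \<Longrightarrow> \<Lambda> \<alpha> p p = p"
  using Lam_base_change[of \<alpha> p p p] by (simp add: br_cancel_left Lam_closed)

text \<open>Addition is the bracket with middle entry p, so both distributive laws come from the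
  heap axioms of \<Lambda>: for scalars with middle scalar 0, which yields p, and for vectors
  because scaling based at p fixes p.\<close>

lemma module_retract:
  assumes p: "p \<in> A"
  shows "module F (retract A br \<Lambda> p)"
proof (rule moduleI)
  show "cring F" by unfold_locales
  show "abelian_group (retract A br \<Lambda> p)" by (rule abelian_group_retract) fact
  fix \<alpha> \<beta> x assume *: "\<alpha> \<in> carrier F" "\<beta> \<in> carrier F" "x \<in> carrier (retract A br \<Lambda> p)"
  then show "(\<alpha> \<oplus> \<beta>) \<odot>\<^bsub>retract A br \<Lambda> p\<^esub> x
      = \<alpha> \<odot>\<^bsub>retract A br \<Lambda> p\<^esub> x \<oplus>\<^bsub>retract A br \<Lambda> p\<^esub> \<beta> \<odot>\<^bsub>retract A br \<Lambda> p\<^esub> x"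
    using Lam_heap_scalar[of \<alpha> \<zero> \<beta> p x] p by (simp add: a_minus_def Lam_zero)
qed (use p in \<open>auto simp: Lam_closed Lam_heap_point Lam_same Lam_mult Lam_one\<close>)

lemma affine_torsor_retract:
  assumes p: "p \<in> A"
  shows "affine_torsor F (retract A br \<Lambda> p) A (\<lambda>a v. br a p v)"
proof -
  interpret M: module F "retract A br \<Lambda> p" by (rule module_retract) fact
  show ?thesis
  proof
    fix a v assume *: "a \<in> A" "v \<in> carrier (retract A br \<Lambda> p)" "br a p v = a"
    then show "v = \<zero>\<^bsub>retract A br \<Lambda> p\<^esub>"
      \<comment> \<open>Applying \<open>br p a\<close> to both sides of \<open>br a p v = a\<close>
        gives v on the left and p on the right.\<close>
      using p br_br_through[of p p v a] by (simp add: br_cancel_left br_cancel_right)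
  next
    fix a b assume "a \<in> A" "b \<in> A"
    then show "\<exists>v\<in>carrier (retract A br \<Lambda> p). b = br a p v"
      using p by (intro bexI[of _ "br p a b"]) (simp_all add: br_br_through br_closed br_cancel_left)
  qed (use p nonempty in \<open>auto simp: br_closed br_cancel_right br_assoc\<close>)
qed

lemma arrow_retract:
  assumes "p \<in> A" "a \<in> A" "b \<in> A"
  shows "arrow (retract A br \<Lambda> p) (\<lambda>a v. br a p v) a b = br p a b"
  using affine_torsor.arrow_eq[OF affine_torsor_retract, of p a "br p a b"] assms
  by (simp add: br_closed br_br_through br_cancel_left)

lemma torsor_heap_retract:
  assumes "p \<in> A" "a \<in> A" "b \<in> A" "c \<in> A"
  shows "torsor_heap (retract A br \<Lambda> p) (\<lambda>a v. br a p v) a b c = br a b c"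
  using assms by (simp add: torsor_heap_def arrow_retract br_br_through)

text \<open>Scaling the arrow \<open>br p a b\<close> at p and adding it to a gives the base change
  formula for \<Lambda> with its outer entries swapped.\<close>

lemma torsor_Lam_retract:
  assumes "p \<in> A" "\<alpha> \<in> carrier F" "a \<in> A" "b \<in> A"
  shows "torsor_Lam (retract A br \<Lambda> p) (\<lambda>a v. br a p v) \<alpha> a b = \<Lambda> \<alpha> a b"
proof -
  have "torsor_Lam (retract A br \<Lambda> p) (\<lambda>a v. br a p v) \<alpha> a b = br a (\<Lambda> \<alpha> p a) (\<Lambda> \<alpha> p b)"
    using assms
    by (simp add: torsor_Lam_def arrow_retract Lam_heap_point Lam_same br_br_through Lam_closed)
  then show ?thesis
    using assms Lam_base_change[of \<alpha> a b p] br_commute[of a] by (simp add: Lam_closed)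
qed

text \<open>Addition in the retract is also its action on A, so source and target are the same
  affine space, with the original operations.\<close>

lemma affine_to_vectors_retract:
  assumes "p \<in> A"
  shows "affine_to_vectors F (retract A br \<Lambda> p) A (\<lambda>a v. br a p v) f
         \<longleftrightarrow> affine_hom F A br \<Lambda> A br \<Lambda> f"
  using assms
  by (auto simp: affine_to_vectors_def affine_hom_def heap_hom_def torsor_heap_retract
      torsor_Lam_retract Pi_iff)

end

section \<open>Linear parts and the Jacobi identity in the retract\<close>

context heap_of_lie_affebras
begin

lemma tern_closed: "\<lbrakk>a \<in> A; b \<in> A; c \<in> A\<rbrakk> \<Longrightarrow> tern a b c \<in> A"
  using tern_hom_3[of a b] by (auto simp: heap_hom_def)

text \<open>The sum of a and v is \<open>br a p v\<close>. Preservation of this bracket in the first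
  argument makes the increment the value at v minus the value at the zero vector p.\<close>

lemma linear_part_retract:
  assumes p: "p \<in> A" "c \<in> A" "v \<in> A"
  shows "linear_part (retract A br \<Lambda> p) A (\<lambda>a v. br a p v) (\<lambda>x. tern x p c) v
         = tern v p c \<ominus>\<^bsub>retract A br \<Lambda> p\<^esub> tern p p c"
proof -
  interpret T: affine_torsor F "retract A br \<Lambda> p" A "\<lambda>a v. br a p v"
    by (rule affine_torsor_retract) fact
  show ?thesis
  proof (rule T.linear_part_eqI)
    fix a assume a: "a \<in> A"
    have "tern (br a p v) p c = br (tern a p c) (tern p p c) (tern v p c)"
      using tern_hom_1[of p c] a p by (simp add: heap_hom_def)
    also have "\<dots> = tern a p c \<ominus>\<^bsub>retract A br \<Lambda> p\<^esub> tern p p c \<oplus>\<^bsub>retract A br \<Lambda> p\<^esub> tern v p c"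
      using a p by (intro br_retract) (simp_all add: tern_closed)
    also have "\<dots> = tern a p c \<oplus>\<^bsub>retract A br \<Lambda> p\<^esub> (tern v p c \<ominus>\<^bsub>retract A br \<Lambda> p\<^esub> tern p p c)"
      using a p T.M.a_ac T.M.minus_eq T.M.a_inv_closed tern_closed
      by (metis retract_simps(1))
    finally show "tern (br a p v) p c
      = tern a p c \<oplus>\<^bsub>retract A br \<Lambda> p\<^esub> (tern v p c \<ominus>\<^bsub>retract A br \<Lambda> p\<^esub> tern p p c)" .
  next
    show "tern v p c \<ominus>\<^bsub>retract A br \<Lambda> p\<^esub> tern p p c \<in> carrier (retract A br \<Lambda> p)"
      using p by (intro T.M.minus_closed) (simp_all add: tern_closed)
  qed (use p in \<open>auto simp: tern_closed\<close>)
qed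

end

text \<open>Links the two forms of the Jacobi identity. In its application x, y, z are the nested
  brackets and p, q, r the brackets with the zero vector in the first place, so each summand of the
  conclusion is a linear part.\<close>

lemma (in abelian_group) jacobi_rearrange:
  assumes "p \<in> carrier G" "q \<in> carrier G" "r \<in> carrier G"
    and "x \<in> carrier G" "y \<in> carrier G" "z \<in> carrier G"
    and "x = p \<ominus> y \<oplus> q \<ominus> z \<oplus> r"
  shows "(x \<ominus> r) \<oplus> (y \<ominus> p) \<oplus> (z \<ominus> q) = \<zero>"
proof -
  have "x \<ominus> r = (p \<ominus> y) \<oplus> (q \<ominus> z)"
    using assms by (simp add: add_minus_cancel) (simp add: minus_eq a_assoc)
  moreover have "(y \<ominus> p) \<oplus> (z \<ominus> q) = \<ominus> ((p \<ominus> y) \<oplus> (q \<ominus> z))"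
    using assms(1-6) by (simp add: minus_add minus_minus_swap)
  ultimately show ?thesis
    using assms(1-6) r_neg[of "(p \<ominus> y) \<oplus> (q \<ominus> z)"] by (simp add: a_assoc)
qed

lemma (in heap_of_lie_affebras) lie_affebra_retract:
  assumes p: "p \<in> A"
  shows "lie_affebra F (retract A br \<Lambda> p) A (\<lambda>a v. br a p v) (\<lambda>a b. tern a p b)"
proof -
  let ?R = "retract A br \<Lambda> p"
  interpret T: affine_torsor F ?R A "\<lambda>a v. br a p v"
    by (rule affine_torsor_retract) fact
  show ?thesis
  proof
    fix b assume "b \<in> A"
    then show "affine_to_vectors F ?R A (\<lambda>a v. br a p v) (\<lambda>a. tern a p b)"
      using p tern_affine_1 by (simp add: affine_to_vectors_retract)
  next
    fix a assume "a \<in> A"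
    then show "affine_to_vectors F ?R A (\<lambda>a v. br a p v) (\<lambda>b. tern a p b)"
      using p tern_affine_3 by (simp add: affine_to_vectors_retract)
  next
    fix a b assume "a \<in> A" "b \<in> A"
    then show "tern a p b = \<ominus>\<^bsub>?R\<^esub> tern b p a"
      \<comment> \<open>With middle argument p, the heap form of antisymmetry says that the two
        brackets add up to the zero p of the retract.\<close>
      using p tern_antisym[of a p b] T.M.minus_equality[of "tern a p b" "tern b p a"]
      by (simp add: tern_closed)
  next
    fix a b c assume *: "a \<in> A" "b \<in> A" "c \<in> A"
    have jac: "tern (tern a p b) p c =
          tern p p a \<ominus>\<^bsub>?R\<^esub> tern (tern b p c) p a \<oplus>\<^bsub>?R\<^esub> tern p p b
            \<ominus>\<^bsub>?R\<^esub> tern (tern c p a) p b \<oplus>\<^bsub>?R\<^esub> tern p p c"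
      unfolding tern_jacobi[OF * p] br5_def using * p
      \<comment> \<open>Both nested brackets of \<open>br5\<close> become alternating sums. The
        bracket does not determine \<Lambda>, so it is supplied.\<close>
      by (subst (1 2) br_retract[OF _ _ _ p, where \<Lambda> = \<Lambda>])
        (simp_all only: tern_closed br_closed)
    show "linear_part ?R A (\<lambda>a v. br a p v) (\<lambda>x. tern x p c) (tern a p b) \<oplus>\<^bsub>?R\<^esub>
       linear_part ?R A (\<lambda>a v. br a p v) (\<lambda>x. tern x p a) (tern b p c) \<oplus>\<^bsub>?R\<^esub>
       linear_part ?R A (\<lambda>a v. br a p v) (\<lambda>x. tern x p b) (tern c p a) = \<zero>\<^bsub>?R\<^esub>"
      using * p unfolding linear_part_retract[OF p *(1) tern_closed[OF *(2) p *(3)]]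
        linear_part_retract[OF p *(2) tern_closed[OF *(3) p *(1)]]
        linear_part_retract[OF p *(3) tern_closed[OF *(1) p *(2)]]
      by (intro T.M.jacobi_rearrange[OF _ _ _ _ _ _ jac]) (simp_all only: retract_simps(1) tern_closed)
  qed
qed

theorem proposition3p5:
  fixes F :: "('f, 'm) ring_scheme"
  assumes "field F"
  shows
    "(\<forall>(V :: ('f, 'v, 'n) module_scheme) (A :: 'a set) act lie.
        lie_affebra F V A act lie \<longrightarrow> ring_char F \<noteq> 2 \<longrightarrow>
          heap_of_lie_affebras F A (torsor_heap V act) (torsor_Lam V act)
            (\<lambda>a b c. act b (lie a c)) \<and>
          strong_jacobi A (torsor_heap V act) (\<lambda>a b c. act b (lie a c)))
     \<and>
     (\<forall>(A :: 'b set) br \<Lambda> tern.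
        heap_of_lie_affebras F A br \<Lambda> tern \<longrightarrow>
          (\<forall>p\<in>A. lie_affebra F (retract A br \<Lambda> p) A (\<lambda>a v. br a p v) (\<lambda>a b. tern a p b)))"
  by (simp add: lie_affebra.heap_of_lie_affebras_lie lie_affebra.strong_jacobi_lie
      heap_of_lie_affebras.lie_affebra_retract)

end
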